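(* Consider a well-formed cross-chain deal executed with the timelock protocol in the synchronous communication model with bound $\Delta$, where an arbitrary number of the participating parties may be deviating. Then the timelock protocol satisfies weak liveness: in every protocol execution, no compliant party's outgoing assets are locked up (held in escrow) forever.
   Context: **Parties, assets, contracts.** A deal $D$ involves a finite list $\mathit{plist}$ of $N$ parties. Each asset has exactly one owner at a time and lives on a blockchain. A blockchain is a publicly readable, tamper-proof ledger that can host contracts. Contracts are public, deterministic, passive, trusted programs, which see only data on their own blockchain or data submitted to them by parties. Every party can read the state of any contract. Signatures cannot be forged and messages cannot be replayed (deal identifiers are unique). A party is *compliant* if it follows the protocol below. Otherwise it is *deviating* and may behave arbitrarily. There is no bound on the number of deviating parties. **Deal.** A deal specifies a set of transfers of assets between parties. It is viewed as a directed graph whose vertices are the parties and whose arcs are the transfers. A transfer from $P$ to $Q$ is an *outgoing* transfer (asset) of $P$ and an *incoming* transfer (asset) of $Q$. A party may relay an asset, so the same asset can be both incoming and outgoing for a party. The deal is *well-formed*, which here means that its digraph is strongly connected. **Synchronous model.** $\Delta>0$ is a known (finite) bound on propagation time. If a vote is accepted by a contract at time $t$, a compliant party monitoring that contract can observe it and have it delivered, forwarded, to other contracts by time $t+\Delta$. **Timelock protocol.** 1. *Clearing.* All parties are sent $D$, $\mathit{plist}$, a (finite) commit-phase starting time $t_0$ and $\Delta$ by an untrusted service. The time $t_0$ is far enough in the future for the escrow, transfer and validation steps of compliant parties to finish before it. 2. *Escrow.* The owner of an asset $a$ (who must be in $\mathit{plist}$) may place it in escrow with an escrow contract on $a$'s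 blockchain, recording $D,\mathit{plist},t_0,\Delta$. The contract becomes the owner of $a$. The contract records an abort-owner $A(a)$ and a commit-owner $C(a)$, both initially the escrowing party. Each compliant party escrows its outgoing assets that it initially owns. 3. *Transfer.* The current commit-owner $P=C(a)$ of an escrowed asset $a$ (and only $P$) may tentatively transfer it to a party $Q\in\mathit{plist}$, which sets $C(a):=Q$. Compliant parties perform the tentative transfers specified by the deal. 4. *Validation.* Each compliant party checks that its incoming assets are properly escrowed with the correct deal information, and that the payoff in which all its tentatively transferred incoming and outgoing assets are transferred is acceptable to it. If so it votes to commit. Otherwise it does not vote. 5. *Commit.* A vote of party $v$ carries a *path signature* $p$, a sequence of signatures beginning with $v$'s and followed by those of the successive parties that forwarded it. $|p|$ denotes the number of distinct signers. A compliant party that votes to commit sends its directly signed vote ($|p|=1$) to the escrow contract of each of its incoming assets, arriving before $t_0+\Delta$. It also monitors the escrow contracts of its outgoing assets. Whenever a new vote of some party (with path signature $p$) is accepted there, it appends its own signature and forwards the vote to the escrow contracts of all its incoming assets, unless it has already done so for that voter. (It may also send votes to other contracts.) A contract accepts a vote of $v$ with path signature $p$ if and only if it arrives before time $t_0+|p|\cdot\Delta$, all signers in $p$ are distinct members of $\mathit{plist}$, and all signatures are valid and attest to a vote from $v$. 6. *Release or refund.* When an escrow contract has accepted a commit vote from every party in $\mathit{plist}$, it releases its escrowed asset $a$ to $C(a)$, so the tentative transfers of $a$ become permanent. If it has not accepted a vote from every party by time $t_0+N\cdot\Delta$, it times out and refunds $a$ to $A(a)$, so no transfer of $a$ takes place.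 *)

theory Defs
  imports Complex_Main "Graph_Theory.Graph_Theory"
begin

section \<open>Deals\<close>

text \<open>A transfer \<open>(P, a, Q)\<close> is an arc from \<open>P\<close> to \<open>Q\<close> labelled with the asset \<open>a\<close>.
  Parallel arcs with different assets are possible, and the same asset may label several arcs.\<close>

type_synonym ('p, 'a) transfer = "'p \<times> 'a \<times> 'p"

text \<open>The data sent out by the clearing service and recorded by an escrow contract.\<close>

record ('p, 'a) deal_info =
  transfers :: "('p, 'a) transfer set"
  plist :: "'p list"
  start_time :: real
  delta :: real

definition deal_digraph :: "('p, 'a) deal_info \<Rightarrow> ('p, ('p, 'a) transfer) pre_digraph" where
  "deal_digraph d =
     \<lparr>verts = set (plist d), arcs = transfers d,
      tail = (\<lambda>(P, a, Q). P), head = (\<lambda>(P, a, Q). Q)\<rparr>"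

definition well_formed_deal :: "('p, 'a) deal_info \<Rightarrow> bool" where
  "well_formed_deal d \<longleftrightarrow>
     distinct (plist d) \<and> wf_digraph (deal_digraph d) \<and> strongly_connected (deal_digraph d)"

definition outgoing_assets :: "('p, 'a) deal_info \<Rightarrow> 'p \<Rightarrow> 'a set" where
  "outgoing_assets d P = {a. \<exists>Q. (P, a, Q) \<in> transfers d}"

definition incoming_assets :: "('p, 'a) deal_info \<Rightarrow> 'p \<Rightarrow> 'a set" where
  "incoming_assets d P = {a. \<exists>Q. (Q, a, P) \<in> transfers d}"


section \<open>Contracts and global states\<close>

type_synonym contract_id = nat

datatype 'p holder = Party 'p | Escrow contract_id

text \<open>\<open>terms\<close> is the deal information recorded at escrow time; a deviating party may record
  anything there. \<open>tentative\<close> is the log of tentative transfers (from, to), \<open>voters\<close> the set of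
  parties whose vote has been accepted. A contract is active until it releases or refunds.\<close>

record ('p, 'a) contract =
  asset :: 'a
  terms :: "('p, 'a) deal_info"
  abort_owner :: 'p
  commit_owner :: 'p
  tentative :: "('p \<times> 'p) list"
  voters :: "'p set"
  active :: bool

text \<open>\<open>(d, p) \<in> signed s\<close> means that the path signature \<open>p\<close> on a commit vote of \<open>hd p\<close> for the
  deal \<open>d\<close> has been produced by the signers in \<open>p\<close>. Tagging it with \<open>d\<close> excludes replay in other
  deals.\<close>

record ('p, 'a) state =
  owner :: "'a \<Rightarrow> 'p holder"
  contracts :: "contract_id \<Rightarrow> ('p, 'a) contract option"
  signed :: "(('p, 'a) deal_info \<times> 'p list) set"

definition deadline :: "('p, 'a) contract \<Rightarrow> real" where
  "deadline k = start_time (terms k) + real (length (plist (terms k))) * delta (terms k)"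

definition accepts :: "real \<Rightarrow> (('p, 'a) deal_info \<times> 'p list) set \<Rightarrow> ('p, 'a) contract \<Rightarrow> 'p list \<Rightarrow> bool"
  where
  "accepts t S k p \<longleftrightarrow>
     active k \<and> p \<noteq> [] \<and> distinct p \<and> set p \<subseteq> set (plist (terms k)) \<and> (terms k, p) \<in> S \<and>
     t < start_time (terms k) + real (card (set p)) * delta (terms k)"

text \<open>Accepting the last missing vote releases the asset to the commit-owner.\<close>

definition add_vote :: "contract_id \<Rightarrow> ('p, 'a) contract \<Rightarrow> 'p \<Rightarrow> ('p, 'a) state \<Rightarrow> ('p, 'a) state" where
  "add_vote c k v s =
     (let V = insert v (voters k) in
      if set (plist (terms k)) \<subseteq> V
      then s\<lparr>contracts := (contracts s)(c \<mapsto> k\<lparr>voters := V, active := False\<rparr>),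
             owner := (owner s)(asset k := Party (commit_owner k))\<rparr>
      else s\<lparr>contracts := (contracts s)(c \<mapsto> k\<lparr>voters := V\<rparr>)\<rparr>)"

text \<open>Events name the party that has authority for them; the rules below hold for compliant and
  deviating parties alike.
  \<^item> \<open>DoEscrow P a c d\<close>: \<open>P\<close> escrows \<open>a\<close> with the new contract \<open>c\<close>, recording \<open>d\<close>.
  \<^item> \<open>DoTransfer P c Q\<close>: \<open>P\<close> tentatively transfers the asset escrowed with \<open>c\<close> to \<open>Q\<close>.
  \<^item> \<open>Sign P d p\<close>: \<open>P\<close> appends its signature to \<open>p\<close>; with \<open>p = []\<close> it signs its own vote.
  \<^item> \<open>Arrive c p\<close>: a vote with path signature \<open>p\<close>, sent by anybody, arrives at \<open>c\<close>.
  \<^item> \<open>Timeout c\<close>: \<open>c\<close> times out.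
  \<^item> \<open>Give P a Q\<close>: \<open>P\<close> hands over an asset that is not in escrow, outside the protocol.\<close>

datatype ('p, 'a) event =
    DoEscrow 'p 'a contract_id "('p, 'a) deal_info"
  | DoTransfer 'p contract_id 'p
  | Sign 'p "('p, 'a) deal_info" "'p list"
  | Arrive contract_id "'p list"
  | Timeout contract_id
  | Give 'p 'a 'p
  | Idle

inductive step :: "real \<Rightarrow> ('p, 'a) state \<Rightarrow> ('p, 'a) event \<Rightarrow> ('p, 'a) state \<Rightarrow> bool" for t s where
  escrow: "owner s a = Party P \<Longrightarrow> P \<in> set (plist d) \<Longrightarrow> contracts s c = None \<Longrightarrow>
    step t s (DoEscrow P a c d)
      (s\<lparr>owner := (owner s)(a := Escrow c),
         contracts := (contracts s)(c \<mapsto>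
           \<lparr>asset = a, terms = d, abort_owner = P, commit_owner = P, tentative = [],
            voters = {}, active = True\<rparr>)\<rparr>)"
| transfer: "contracts s c = Some k \<Longrightarrow> active k \<Longrightarrow> commit_owner k = P \<Longrightarrow>
    Q \<in> set (plist (terms k)) \<Longrightarrow>
    step t s (DoTransfer P c Q)
      (s\<lparr>contracts := (contracts s)(c \<mapsto>
           k\<lparr>commit_owner := Q, tentative := tentative k @ [(P, Q)]\<rparr>)\<rparr>)"
| sign: "p = [] \<or> (d, p) \<in> signed s \<Longrightarrow>
    step t s (Sign P d p) (s\<lparr>signed := insert (d, p @ [P]) (signed s)\<rparr>)"
| accept: "contracts s c = Some k \<Longrightarrow> accepts t (signed s) k p \<Longrightarrow>
    step t s (Arrive c p) (add_vote c k (hd p) s)"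
| reject: "\<not> (\<exists>k. contracts s c = Some k \<and> accepts t (signed s) k p) \<Longrightarrow>
    step t s (Arrive c p) s"
| timeout: "contracts s c = Some k \<Longrightarrow> active k \<Longrightarrow> deadline k \<le> t \<Longrightarrow>
    step t s (Timeout c)
      (s\<lparr>contracts := (contracts s)(c \<mapsto> k\<lparr>active := False\<rparr>),
         owner := (owner s)(asset k := Party (abort_owner k))\<rparr>)"
| give: "owner s a = Party P \<Longrightarrow>
    step t s (Give P a Q) (s\<lparr>owner := (owner s)(a := Party Q)\<rparr>)"
| idle: "step t s Idle s"


section \<open>Timed runs\<close>

text \<open>Event \<open>i\<close> happens at time \<open>time x i\<close> and leads from \<open>state_at x i\<close> to \<open>state_at x (Suc i)\<close>.\<close>

record ('p, 'a) run =
  state_at :: "nat \<Rightarrow> ('p, 'a) state"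
  event_at :: "nat \<Rightarrow> ('p, 'a) event"
  time_at :: "nat \<Rightarrow> real"

definition initial_state :: "('p, 'a) state \<Rightarrow> bool" where
  "initial_state s \<longleftrightarrow>
     (\<forall>a. \<exists>P. owner s a = Party P) \<and> (\<forall>c. contracts s c = None) \<and> signed s = {}"

text \<open>In the last conjunct, a contract that is active after event \<open>i\<close> does not let time pass beyond
  its deadline. So it times out exactly at its deadline, or as soon as it is created if the recorded
  deadline is already over.\<close>

definition timed_run :: "('p, 'a) run \<Rightarrow> bool" where
  "timed_run x \<longleftrightarrow>
     initial_state (state_at x 0) \<and>
     (\<forall>i. step (time_at x i) (state_at x i) (event_at x i) (state_at x (Suc i))) \<and>
     mono (time_at x) \<and> filterlim (time_at x) at_top sequentially \<and>
     (\<forall>i c k. contracts (state_at x (Suc i)) c = Some k \<and> active k \<longrightarrow>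
        time_at x (Suc i) \<le> max (time_at x i) (deadline k))"


section \<open>Compliant parties\<close>

definition deal_contract ::
    "('p, 'a) deal_info \<Rightarrow> ('p, 'a) state \<Rightarrow> contract_id \<Rightarrow> ('p, 'a) contract \<Rightarrow> bool" where
  "deal_contract d s c k \<longleftrightarrow> contracts s c = Some k \<and> terms k = d \<and> active k"

definition incoming_contracts :: "('p, 'a) deal_info \<Rightarrow> 'p \<Rightarrow> ('p, 'a) state \<Rightarrow> contract_id set" where
  "incoming_contracts d P s = {c. \<exists>k. deal_contract d s c k \<and> asset k \<in> incoming_assets d P}"

definition tentative_transfers :: "('p, 'a) deal_info \<Rightarrow> ('p, 'a) state \<Rightarrow> ('p, 'a) transfer set" where
  "tentative_transfers d s =
     {(P, a, Q). \<exists>c k. deal_contract d s c k \<and> asset k = a \<and> (P, Q) \<in> set (tentative k)}"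

text \<open>\<open>acceptable P I O\<close>: party \<open>P\<close> accepts the payoff in which the transfers \<open>I\<close> to it and the
  transfers \<open>O\<close> from it take place.\<close>

type_synonym ('p, 'a) preference =
  "'p \<Rightarrow> ('p, 'a) transfer set \<Rightarrow> ('p, 'a) transfer set \<Rightarrow> bool"

definition validates ::
    "('p, 'a) preference \<Rightarrow> ('p, 'a) deal_info \<Rightarrow> 'p \<Rightarrow> ('p, 'a) state \<Rightarrow> bool" where
  "validates acceptable d P s \<longleftrightarrow>
     (\<forall>a \<in> incoming_assets d P. \<exists>c k. deal_contract d s c k \<and> asset k = a) \<and>
     acceptable P {(Q, a, R) \<in> tentative_transfers d s. R = P}
                  {(Q, a, R) \<in> tentative_transfers d s. Q = P}"

definition outstanding :: "('p, 'a) deal_info \<Rightarrow> ('p, 'a) run \<Rightarrow> nat \<Rightarrow> ('p, 'a) transfer \<Rightarrow> bool" where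
  "outstanding d x i = (\<lambda>(P, a, Q). (P, a, Q) \<in> transfers d \<and>
     \<not> (\<exists>j<i. \<exists>c k. event_at x j = DoTransfer P c Q \<and>
           contracts (state_at x j) c = Some k \<and> terms k = d \<and> asset k = a))"

text \<open>Escrow and transfer steps of \<open>P\<close>, all taken before its validation at index \<open>n\<close>.\<close>

definition follows_escrow :: "('p, 'a) deal_info \<Rightarrow> ('p, 'a) run \<Rightarrow> nat \<Rightarrow> 'p \<Rightarrow> bool" where
  "follows_escrow d x n P \<longleftrightarrow>
     (\<forall>a \<in> outgoing_assets d P. owner (state_at x 0) a = Party P \<longrightarrow>
        (\<exists>i<n. \<exists>c. event_at x i = DoEscrow P a c d)) \<and>
     (\<forall>i a c. event_at x i = DoEscrow P a c d \<longrightarrow>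
        i < n \<and> a \<in> outgoing_assets d P \<and> owner (state_at x 0) a = Party P)"

definition follows_transfer :: "('p, 'a) deal_info \<Rightarrow> ('p, 'a) run \<Rightarrow> nat \<Rightarrow> 'p \<Rightarrow> bool" where
  "follows_transfer d x n P \<longleftrightarrow>
     (\<forall>c k Q. deal_contract d (state_at x n) c k \<and> commit_owner k = P \<longrightarrow>
        \<not> outstanding d x n (P, asset k, Q)) \<and>
     (\<forall>i c k Q. event_at x i = DoTransfer P c Q \<and> deal_contract d (state_at x i) c k \<longrightarrow>
        i < n \<and> outstanding d x i (P, asset k, Q))"

definition delivered :: "('p, 'a) deal_info \<Rightarrow> ('p, 'a) run \<Rightarrow> nat \<Rightarrow> contract_id \<Rightarrow> 'p list \<Rightarrow> bool" where
  "delivered d x i c p \<longleftrightarrow> event_at x i = Arrive c p \<and> (d, p) \<in> signed (state_at x i)"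

definition accepted_at_outgoing :: "('p, 'a) deal_info \<Rightarrow> ('p, 'a) run \<Rightarrow> 'p \<Rightarrow> nat \<Rightarrow> 'p list \<Rightarrow> bool" where
  "accepted_at_outgoing d x P i p \<longleftrightarrow>
     (\<exists>c k. event_at x i = Arrive c p \<and> deal_contract d (state_at x i) c k \<and>
        asset k \<in> outgoing_assets d P \<and> accepts (time_at x i) (signed (state_at x i)) k p)"

text \<open>\<open>P\<close> forwards the vote of each other voter once, with the path signature with which it first
  sees that vote accepted at an outgoing asset.\<close>

definition to_forward :: "('p, 'a) deal_info \<Rightarrow> ('p, 'a) run \<Rightarrow> 'p \<Rightarrow> nat \<Rightarrow> 'p list \<Rightarrow> bool" where
  "to_forward d x P i p \<longleftrightarrow>
     accepted_at_outgoing d x P i p \<and> hd p \<noteq> P \<and>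
     (\<forall>j<i. \<forall>q. accepted_at_outgoing d x P j q \<longrightarrow> hd q \<noteq> hd p)"

text \<open>The maximum accounts for votes accepted before \<open>P\<close> itself votes, which is when it starts
  forwarding.\<close>

definition follows_commit :: "('p, 'a) deal_info \<Rightarrow> ('p, 'a) run \<Rightarrow> nat \<Rightarrow> 'p \<Rightarrow> bool" where
  "follows_commit d x n P \<longleftrightarrow>
     (\<forall>c \<in> incoming_contracts d P (state_at x n).
        (\<exists>j\<ge>n. delivered d x j c [P] \<and> time_at x j < start_time d + delta d) \<and>
        (\<forall>i p. to_forward d x P i p \<longrightarrow>
           (\<exists>j\<ge>n. delivered d x j c (p @ [P]) \<and>
              time_at x j \<le> max (time_at x i) (time_at x n) + delta d))) \<and>
     (\<forall>i p. event_at x i = Sign P d p \<longrightarrow>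
        i \<ge> n \<and> (p = [] \<or> (\<exists>j<i. to_forward d x P j p)))"

text \<open>\<open>n\<close> is the index at which \<open>P\<close> validates. That the starting time is far enough in the future
  is expressed by \<open>P\<close> having validated before it. Steps of \<open>P\<close> in other deals are not
  constrained.\<close>

definition compliant ::
    "('p, 'a) preference \<Rightarrow> ('p, 'a) deal_info \<Rightarrow> ('p, 'a) run \<Rightarrow> 'p \<Rightarrow> bool" where
  "compliant acceptable d x P \<longleftrightarrow>
     (\<exists>n. time_at x n < start_time d \<and> follows_escrow d x n P \<and> follows_transfer d x n P \<and>
        (if validates acceptable d P (state_at x n) then follows_commit d x n P
         else \<forall>i p. event_at x i \<noteq> Sign P d p))"

text \<open>The parties in \<open>C\<close> follow the protocol, all others are unconstrained.\<close>

definition protocol_execution ::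
    "('p, 'a) preference \<Rightarrow> ('p, 'a) deal_info \<Rightarrow> 'p set \<Rightarrow> ('p, 'a) run \<Rightarrow> bool" where
  "protocol_execution acceptable d C x \<longleftrightarrow>
     timed_run x \<and> C \<subseteq> set (plist d) \<and> (\<forall>P \<in> C. compliant acceptable d x P)"


section \<open>Weak liveness\<close>

text \<open>The asset may go from one escrow contract to the next; it suffices for being locked forever that
  it is never again held by a party. As time diverges in a run, all later indices cover all later
  times.\<close>

definition in_escrow :: "('p, 'a) state \<Rightarrow> 'a \<Rightarrow> bool" where
  "in_escrow s a \<longleftrightarrow> (\<exists>c. owner s a = Escrow c)"

definition locked_forever :: "('p, 'a) run \<Rightarrow> 'a \<Rightarrow> bool" where
  "locked_forever x a \<longleftrightarrow> (\<exists>i. \<forall>j\<ge>i. in_escrow (state_at x j) a)"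

text \<open>For all executions, whatever the payoffs acceptable to the parties and whichever parties are
  compliant.\<close>

definition weak_liveness :: "('p, 'a) deal_info \<Rightarrow> bool" where
  "weak_liveness d \<longleftrightarrow>
     (\<forall>acceptable C x. protocol_execution acceptable d C x \<longrightarrow>
        (\<forall>P \<in> C. \<forall>a \<in> outgoing_assets d P. \<not> locked_forever x a))"

end

theory Submission
  imports Defs
begin

text \<open>An asset held by an escrow contract can only leave it for a party, so an asset that is locked
  forever stays with one and the same contract, which remains active. As an active contract does not
  let time pass beyond its deadline, the times of the run would be bounded, although they diverge.\<close>

definition escrows_backed :: "('p, 'a) state \<Rightarrow> bool" where
  "escrows_backed s \<longleftrightarrow>
     (\<forall>a c. owner s a = Escrow c \<longrightarrow> (\<exists>k. contracts s c = Some k \<and> active k \<and> asset k = a))"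

lemma escrows_backedD:
  assumes "escrows_backed s" and "owner s a = Escrow c"
  obtains k where "contracts s c = Some k" "active k" "asset k = a"
  using assms unfolding escrows_backed_def by blast

lemma escrows_backed_initial: "initial_state s \<Longrightarrow> escrows_backed s"
  unfolding initial_state_def escrows_backed_def by (metis holder.distinct(1))

text \<open>A contract becomes inactive only on release or timeout, and both hand its asset to a
  party in the same step; \<open>asset k = a\<close> ensures that this asset is \<open>a\<close>. A
  new escrow takes a fresh identifier, so it overwrites no backing contract.\<close>

lemma escrows_backed_step:
  assumes "step t s e s'" and "escrows_backed s"
  shows "escrows_backed s'"
  using assms
  by (cases rule: step.cases)
    (fastforce simp: escrows_backed_def add_vote_def Let_def split: if_splits)+

text \<open>Only \<open>DoEscrow\<close> puts an asset in escrow, and it requires a party as current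
  owner, so a change of contract has to pass through a state where a party holds the asset.\<close>

lemma step_owner_Escrow:
  assumes "step t s e s'" and "owner s a = Escrow c" and "owner s' a = Escrow c'"
  shows "c' = c"
  using assms
  by (cases rule: step.cases) (auto simp: add_vote_def Let_def split: if_splits)

text \<open>No event rewrites \<open>terms\<close>, and a new escrow never reuses an
  identifier.\<close>

lemma step_deadline:
  assumes "step t s e s'" and "contracts s c = Some k" and "contracts s' c = Some k'"
  shows "deadline k' = deadline k"
  using assms
  by (cases rule: step.cases) (auto simp: deadline_def add_vote_def Let_def split: if_splits)

lemma timed_run_step:
  "timed_run x \<Longrightarrow> step (time_at x i) (state_at x i) (event_at x i) (state_at x (Suc i))"
  by (simp add: timed_run_def)

lemma timed_run_escrows_backed:
  assumes "timed_run x"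
  shows "escrows_backed (state_at x i)"
proof (induction i)
  case 0
  show ?case using assms by (simp add: timed_run_def escrows_backed_initial)
next
  case (Suc i)
  then show ?case using escrows_backed_step[OF timed_run_step[OF assms]] by blast
qed

lemma timed_run_not_locked_forever:
  assumes x: "timed_run x"
  shows "\<not> locked_forever x a"
proof
  assume "locked_forever x a"
  then obtain i where locked: "\<And>j. i \<le> j \<Longrightarrow> in_escrow (state_at x j) a"
    unfolding locked_forever_def by blast
  obtain c where c: "owner (state_at x i) a = Escrow c"
    using locked[of i] by (auto simp: in_escrow_def)
  obtain k where k: "contracts (state_at x i) c = Some k"
    by (rule escrows_backedD[OF timed_run_escrows_backed[OF x] c])
  \<comment> \<open>The recorded terms are arbitrary, so the deadline may already be over at index
    \<open>i\<close>; hence the maximum.\<close>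
  let ?b = "max (time_at x i) (deadline k)"
  \<comment> \<open>Votes and tentative transfers change the contract record, so the induction keeps
    only its identifier and deadline.\<close>
  have "owner (state_at x j) a = Escrow c \<and>
      (\<exists>k'. contracts (state_at x j) c = Some k' \<and> deadline k' = deadline k) \<and>
      time_at x j \<le> ?b" if "i \<le> j" for j
    using that
  proof (induction rule: dec_induct)
    case base
    show ?case using c k by auto
  next
    case (step j)
    note st = timed_run_step[OF x, of j]
    have owner: "owner (state_at x (Suc j)) a = Escrow c"
      using locked[of "Suc j"] step st step_owner_Escrow by (fastforce simp: in_escrow_def)
    \<comment> \<open>The time bound in \<open>timed_run\<close> concerns active contracts only; the
      invariant supplies this activity.\<close>
    then obtain k' where k': "contracts (state_at x (Suc j)) c = Some k'" "active k'"
      by (rule escrows_backedD[OF timed_run_escrows_backed[OF x]])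
    have deadline: "deadline k' = deadline k"
      using step_deadline[OF st _ k'(1)] step.IH by metis
    have "time_at x (Suc j) \<le> max (time_at x j) (deadline k')"
      using x k' by (auto simp: timed_run_def)
    then have "time_at x (Suc j) \<le> ?b"
      using step.IH deadline by (simp add: le_max_iff_disj) linarith
    with owner k'(1) deadline show ?case by blast
  qed
  then have "eventually (\<lambda>j. time_at x j \<le> ?b) sequentially"
    by (auto intro: eventually_sequentiallyI)
  moreover have "eventually (\<lambda>j. ?b < time_at x j) sequentially"
    using x unfolding timed_run_def filterlim_at_top_dense by blast
  ultimately have "eventually (\<lambda>j::nat. False) sequentially"
    by eventually_elim simp
  then show False by simp
qed

theorem theorem2:
  fixes d :: "('p, 'a) deal_info"
  assumes "well_formed_deal d" and "delta d > 0"
  shows "weak_liveness d"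
  unfolding weak_liveness_def protocol_execution_def
  by (simp add: timed_run_not_locked_forever)

end
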